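(* Let $D=\{s\in\mathbb{C}: 0<\Re(s)<\tfrac12\}$. For every $s\in D$ the limit $$L(s)=\lim_{n\to\infty}\frac{\eta_n(1-s)}{\eta_n(s)}$$ exists, and the function $L$ is continuous on $D$ if and only if $\eta(s)\neq 0$ for all $s\in D$.
   Context: The Dirichlet eta function is $\eta(s)=\sum_{n=1}^\infty \frac{(-1)^{n-1}}{n^s}$, convergent for $\Re(s)>0$, and $\eta_n(s)=\sum_{k=1}^{n}\frac{(-1)^{k-1}}{k^s}$ is its $n$-th partial sum. For each $s\in D$ the limit is taken over indices $n>N(s)$, where $N(s)$ is an integer depending on $s$ such that $\eta_n(s)\ne 0$ for all $n>N(s)$; the existence of the limit includes the existence of such an $N(s)$. *)

theory Defs
  imports "HOL-Complex_Analysis.Complex_Analysis"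
begin

definition eta_partial :: "nat \<Rightarrow> complex \<Rightarrow> complex" where
  "eta_partial n s = (\<Sum>k=1..n. (-1) ^ (k - 1) / of_nat k powr s)"

(* The series starts at n = 1, hence the shift of the index. It converges, in general only
   conditionally, for Re s > 0; suminf is the limit of the partial sums in the usual order. *)
definition dirichlet_eta :: "complex \<Rightarrow> complex" where
  "dirichlet_eta s = (\<Sum>n. (-1) ^ n / of_nat (Suc n) powr s)"

definition left_half_strip :: "complex set" where
  "left_half_strip = {s. 0 < Re s \<and> Re s < 1 / 2}"

definition eta_quotient :: "complex \<Rightarrow> nat \<Rightarrow> complex" where
  "eta_quotient s n = eta_partial n (1 - s) / eta_partial n s"

(* Since x / 0 = 0, convergence of the total sequence does not by itself say that the quotients
   are eventually defined, so this is required separately. *)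
definition eta_quotient_limit_exists :: "complex \<Rightarrow> bool" where
  "eta_quotient_limit_exists s \<longleftrightarrow>
     (\<exists>N. \<forall>n>N. eta_partial n s \<noteq> 0) \<and> convergent (eta_quotient s)"

(* Finitely many terms do not affect the limit, so when eta_quotient_limit_exists s holds
   this is the limit over the indices n > N(s). *)
definition eta_quotient_limit :: "complex \<Rightarrow> complex" where
  "eta_quotient_limit s = lim (eta_quotient s)"

end

theory Submission
  imports Defs
begin

text \<open>
  Where \<open>\<eta>(s) \<noteq> 0\<close> the limit is \<open>\<eta>(1 - s) / \<eta>(s)\<close>. A functional equation
  \<open>A(s) \<eta>(s) = E(s) \<eta>(1 - s)\<close> in \<open>0 < Re s < 1\<close>, with \<open>A\<close> free of zeros and \<open>E\<close> locally bounded,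
  shows that zeros come in pairs \<open>s, 1 - s\<close>. At such a pair the remainder asymptotics
  \<open>\<eta>(s) - \<eta>\<^sub>n(s) \<sim> (-1)\<^sup>n n\<^bsup>-s\<^esup> / 2\<close> make the quotient behave like
  \<open>n\<^bsup>2s - 1\<^esup>\<close>, so the limit is \<open>0\<close>; but at the neighbouring points, where \<open>\<eta>\<close> does not vanish,
  the limit has modulus at least \<open>\<bar>A\<bar> / \<bar>E\<bar>\<close>, which is bounded away from \<open>0\<close>. So the limit
  function is discontinuous exactly at the zeros.

  Both the remainder and the functional equation come from Mellin transforms. That of \<open>1 / (exp x + 1)\<close>
  is \<open>\<Gamma>(s) \<eta>(s)\<close>, and in the strip it is an elementary multiple of that of \<open>1 / x - 1 / sinh x\<close>.
  Expanding the latter into the partial fractions \<open>\<Sum> (-1)\<^sup>k\<^sup>-\<^sup>1 2x / (x\<^sup>2 + k\<^sup>2 \<pi>\<^sup>2)\<close> and integrating termwise,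
  which the alternating signs justify, produces \<open>\<eta>(1 - s)\<close>.
\<close>

section \<open>Mellin transforms on the positive half-line: domination, scaling, linearity\<close>

definition mellin_integrable :: "(real \<Rightarrow> real) \<Rightarrow> complex \<Rightarrow> bool" where
  "mellin_integrable f s \<longleftrightarrow>
     set_integrable lborel {0<..} (\<lambda>x. of_real x powr (s - 1) * complex_of_real (f x))"

definition mellin :: "(real \<Rightarrow> real) \<Rightarrow> complex \<Rightarrow> complex" where
  "mellin f s = (LINT x:{0<..}|lborel. of_real x powr (s - 1) * complex_of_real (f x))"

lemma norm_of_real_powr: "0 < x \<Longrightarrow> norm (complex_of_real x powr s) = x powr Re s"
  by (subst norm_powr_real_powr) auto

lemma measurable_mellin_integrand:
  assumes "f \<in> borel_measurable borel"
  shows "set_borel_measurable borel {0<..} (\<lambda>x. of_real x powr (s - 1) * complex_of_real (f x))"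
proof -
  have "(\<lambda>x. indicator {0<..} x *\<^sub>R (complex_of_real x powr (s - 1))) \<in> borel_measurable borel"
    by (intro borel_measurable_continuous_on_indicator continuous_intros) auto
  then have "(\<lambda>x. (indicator {0<..} x *\<^sub>R (complex_of_real x powr (s - 1))) * complex_of_real (f x))
      \<in> borel_measurable borel"
    using assms by measurable
  then show ?thesis by (simp add: set_borel_measurable_def)
qed

lemma norm_mellin_integrand_le:
  assumes "0 < x" "\<bar>f x\<bar> \<le> g x"
  shows "norm (of_real x powr (s - 1) * complex_of_real (f x)) \<le> x powr (Re s - 1) * g x"
  using assms by (auto simp: norm_mult norm_of_real_powr intro!: mult_left_mono)

lemma mellin_integrable_bound:
  assumes "f \<in> borel_measurable borel"
    and "set_integrable lborel {0<..} (\<lambda>x. x powr (Re s - 1) * g x)"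
    and "\<And>x. 0 < x \<Longrightarrow> \<bar>f x\<bar> \<le> g x"
  shows "mellin_integrable f s"
  unfolding mellin_integrable_def
proof (rule set_integrable_bound[OF assms(2)])
  show "set_borel_measurable lborel {0<..} (\<lambda>x. of_real x powr (s - 1) * complex_of_real (f x))"
    using measurable_mellin_integrand[OF assms(1), of s] by (simp add: set_borel_measurable_def)
  show "AE x in lborel. x \<in> {0<..} \<longrightarrow>
      norm (of_real x powr (s - 1) * complex_of_real (f x)) \<le> norm (x powr (Re s - 1) * g x)"
  proof (rule AE_I2, rule impI)
    fix x :: real
    assume "x \<in> {0<..}"
    then have "norm (of_real x powr (s - 1) * complex_of_real (f x)) \<le> x powr (Re s - 1) * g x"
      using assms(3) by (intro norm_mellin_integrand_le) auto
    then show "norm (of_real x powr (s - 1) * complex_of_real (f x)) \<le> norm (x powr (Re s - 1) * g x)"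
      by simp
  qed
qed

lemma norm_mellin_le:
  assumes "f \<in> borel_measurable borel"
    and "set_integrable lborel {0<..} (\<lambda>x. x powr (Re s - 1) * g x)"
    and "\<And>x. 0 < x \<Longrightarrow> \<bar>f x\<bar> \<le> g x"
  shows "norm (mellin f s) \<le> (LINT x:{0<..}|lborel. x powr (Re s - 1) * g x)"
  unfolding mellin_def set_lebesgue_integral_def
proof (rule Bochner_Integration.integral_norm_bound_integral)
  show "integrable lborel (\<lambda>x. indicator {0<..} x *\<^sub>R (of_real x powr (s - 1) * complex_of_real (f x)))"
    using mellin_integrable_bound[OF assms] by (simp add: mellin_integrable_def set_integrable_def)
  show "integrable lborel (\<lambda>x. indicator {0<..} x *\<^sub>R (x powr (Re s - 1) * g x))"
    using assms(2) by (simp add: set_integrable_def)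
  show "norm (indicator {0<..} x *\<^sub>R (of_real x powr (s - 1) * complex_of_real (f x)))
      \<le> indicator {0<..} x *\<^sub>R (x powr (Re s - 1) * g x)" for x
    using norm_mellin_integrand_le[of x f g s] assms(3)[of x]
    by (cases "0 < x") auto
qed

text \<open>Dominated convergence. The majorant \<open>g\<close> bounds only the kernels; the power
  contributes its modulus \<open>x powr (Re s - 1)\<close>.\<close>

lemma mellin_LIMSEQ:
  assumes [measurable]: "f \<in> borel_measurable borel" "\<And>n. F n \<in> borel_measurable borel"
    and "set_integrable lborel {0<..} (\<lambda>x. x powr (Re s - 1) * g x)"
    and "\<And>n x. 0 < x \<Longrightarrow> \<bar>F n x\<bar> \<le> g x"
    and "\<And>x. 0 < x \<Longrightarrow> (\<lambda>n. F n x) \<longlonglongrightarrow> f x"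
  shows "(\<lambda>n. mellin (F n) s) \<longlonglongrightarrow> mellin f s"
  unfolding mellin_def set_lebesgue_integral_def
proof (rule integral_dominated_convergence)
  show "integrable lborel (\<lambda>x. indicator {0<..} x *\<^sub>R (x powr (Re s - 1) * g x))"
    using assms(3) by (simp add: set_integrable_def)
  show "AE x in lborel. norm (indicator {0<..} x *\<^sub>R (of_real x powr (s - 1) * complex_of_real (F n x)))
      \<le> indicator {0<..} x *\<^sub>R (x powr (Re s - 1) * g x)" for n
  proof (rule AE_I2)
    fix x
    show "norm (indicator {0<..} x *\<^sub>R (of_real x powr (s - 1) * complex_of_real (F n x)))
      \<le> indicator {0<..} x *\<^sub>R (x powr (Re s - 1) * g x)"
      using norm_mellin_integrand_le[of x "F n" g s] assms(4)[of x n]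
      by (cases "0 < x") auto
  qed
  show "AE x in lborel. (\<lambda>n. indicator {0<..} x *\<^sub>R (of_real x powr (s - 1) * complex_of_real (F n x)))
      \<longlonglongrightarrow> indicator {0<..} x *\<^sub>R (of_real x powr (s - 1) * complex_of_real (f x))"
  proof (rule AE_I2)
    fix x :: real
    show "(\<lambda>n. indicator {0<..} x *\<^sub>R (of_real x powr (s - 1) * complex_of_real (F n x)))
      \<longlonglongrightarrow> indicator {0<..} x *\<^sub>R (of_real x powr (s - 1) * complex_of_real (f x))"
    proof (cases "0 < x")
      case True
      then show ?thesis by (intro tendsto_intros assms(5))
    qed auto
  qed
qed (use measurable_mellin_integrand[OF assms(1), of s] measurable_mellin_integrand[OF assms(2), of s]
      in \<open>simp_all add: set_borel_measurable_def\<close>)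

lemma
  assumes "0 < a"
  shows mellin_scale: "mellin (\<lambda>x. f (a * x)) s = of_real a powr (- s) * mellin f s"
    and mellin_integrable_scale:
      "mellin_integrable (\<lambda>x. f (a * x)) s \<longleftrightarrow> mellin_integrable f s"
proof -
  define h where "h x = indicator {0<..} x *\<^sub>R (of_real x powr (s - 1) * complex_of_real (f x))" for x :: real
  \<comment> \<open>The summand 0 puts the integrand into the shape of the affine substitution rule.
    The factor is \<open>a powr (1 - s)\<close> because it has to cancel the
    \<open>a powr (s - 1)\<close> hidden in \<open>h (a * x)\<close>.\<close>
  have h: "indicator {0<..} x *\<^sub>R (of_real x powr (s - 1) * complex_of_real (f (a * x)))
      = of_real a powr (1 - s) * h (0 + a * x)" for x
  proof (cases "0 < x")
    case True
    have "of_real (a * x) powr (s - 1) = complex_of_real a powr (s - 1) * of_real x powr (s - 1)"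
      using assms True by (simp add: powr_times_real)
    moreover have "complex_of_real a powr (1 - s) * of_real a powr (s - 1) = 1"
      using assms by (simp flip: powr_add)
    ultimately show ?thesis using assms True
      by (simp add: h_def algebra_simps)
  next
    case False
    then show ?thesis using assms by (simp add: h_def zero_less_mult_iff)
  qed
  have "mellin f s = \<bar>a\<bar> *\<^sub>R (\<integral>x. h (0 + a * x) \<partial>lborel)"
    unfolding mellin_def set_lebesgue_integral_def h_def[symmetric]
    using assms by (intro lborel_integral_real_affine) auto
  moreover have "mellin (\<lambda>x. f (a * x)) s = of_real a powr (1 - s) * (\<integral>x. h (0 + a * x) \<partial>lborel)"
    unfolding mellin_def set_lebesgue_integral_def h by simp
  moreover have "complex_of_real a powr (1 - s) = of_real a * of_real a powr (- s)"
    using assms by (simp add: powr_diff powr_minus field_simps)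
  ultimately show "mellin (\<lambda>x. f (a * x)) s = of_real a powr (- s) * mellin f s"
    using assms by (simp add: scaleR_conv_of_real)
  have "integrable lborel (\<lambda>x. of_real a powr (1 - s) * h (0 + a * x)) \<longleftrightarrow> integrable lborel (\<lambda>x. h (0 + a * x))"
    using assms integrable_mult_right[of "of_real a powr (1 - s)" lborel "\<lambda>x. h (0 + a * x)"]
      integrable_mult_right[of "1 / of_real a powr (1 - s)" lborel "\<lambda>x. of_real a powr (1 - s) * h (0 + a * x)"]
    by auto
  then show "mellin_integrable (\<lambda>x. f (a * x)) s \<longleftrightarrow> mellin_integrable f s"
    unfolding mellin_integrable_def set_integrable_def h h_def[symmetric]
    using assms lborel_integrable_real_affine_iff[of a h 0] by simp
qed

lemma
  assumes "mellin_integrable f s" "mellin_integrable g s"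
  shows mellin_add: "mellin (\<lambda>x. f x + g x) s = mellin f s + mellin g s"
    and mellin_diff: "mellin (\<lambda>x. f x - g x) s = mellin f s - mellin g s"
    and mellin_integrable_add: "mellin_integrable (\<lambda>x. f x + g x) s"
  using assms
  by (simp_all add: mellin_def mellin_integrable_def ring_distribs)

lemma mellin_cmult: "mellin (\<lambda>x. c * f x) s = of_real c * mellin f s"
proof -
  have "mellin (\<lambda>x. c * f x) s =
    (LINT x:{0<..}|lborel. of_real c * (of_real x powr (s - 1) * complex_of_real (f x)))"
    by (simp add: mellin_def mult_ac)
  then show ?thesis by (simp add: mellin_def)
qed

lemma mellin_integrable_cmult: "mellin_integrable f s \<Longrightarrow> mellin_integrable (\<lambda>x. c * f x) s"
proof -
  assume "mellin_integrable f s"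
  then have "set_integrable lborel {0<..} (\<lambda>x. of_real c * (of_real x powr (s - 1) * complex_of_real (f x)))"
    by (simp add: mellin_integrable_def)
  then show ?thesis by (simp add: mellin_integrable_def mult_ac)
qed

lemma mellin_integrable_zero: "mellin_integrable (\<lambda>x. 0) s"
  by (simp add: mellin_integrable_def set_integrable_def)

lemma mellin_integrable_sum:
  "(\<And>k. k \<in> A \<Longrightarrow> mellin_integrable (f k) s) \<Longrightarrow> mellin_integrable (\<lambda>x. \<Sum>k\<in>A. f k x) s"
  by (induction A rule: infinite_finite_induct)
     (simp_all add: mellin_integrable_zero mellin_integrable_add)

lemma mellin_sum:
  "(\<And>k. k \<in> A \<Longrightarrow> mellin_integrable (f k) s) \<Longrightarrow> mellin (\<lambda>x. \<Sum>k\<in>A. f k x) s = (\<Sum>k\<in>A. mellin (f k) s)"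
  by (induction A rule: infinite_finite_induct)
     (simp_all add: mellin_def[of "\<lambda>x. 0"] mellin_add mellin_integrable_sum)

lemma mellin_cong: "(\<And>x. 0 < x \<Longrightarrow> f x = g x) \<Longrightarrow> mellin f s = mellin g s"
  unfolding mellin_def by (intro set_lebesgue_integral_cong) auto

section \<open>Absolute integrability of the weighted majorants\<close>

lemma set_integrable_lborel_iff_absolutely_integrable:
  fixes f :: "real \<Rightarrow> 'a :: euclidean_space"
  assumes "set_borel_measurable borel A f"
  shows "set_integrable lborel A f \<longleftrightarrow> f absolutely_integrable_on A"
  using assms by (simp add: set_integrable_def set_borel_measurable_def integrable_completion)

lemma measurable_real_mellin_integrand:
  assumes "f \<in> borel_measurable borel"
  shows "set_borel_measurable borel {0<..} (\<lambda>x::real. x powr a * f x :: real)"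
  using assms unfolding set_borel_measurable_def by measurable

text \<open>The integrand is the modulus of the complex Gamma integrand at the real point \<sigma>;
  being Borel measurable, it is integrable over \<open>lborel\<close> as soon as it is over the
  completed measure.\<close>

lemma set_integrable_Gamma:
  assumes "0 < \<sigma>"
  shows "set_integrable lborel {0<..} (\<lambda>x::real. x powr (\<sigma> - 1) * exp (- x))"
proof -
  have "(\<lambda>t. complex_of_real t powr (of_real \<sigma> - 1) / of_real (exp t)) absolutely_integrable_on {0<..}"
    using assms by (intro absolutely_integrable_Gamma_integral') auto
  then have "(\<lambda>t. norm (complex_of_real t powr (of_real \<sigma> - 1) / of_real (exp t))) absolutely_integrable_on {0<..}"
    by (rule absolutely_integrable_norm[unfolded o_def])
  also have "?this \<longleftrightarrow> (\<lambda>x. x powr (\<sigma> - 1) * exp (- x)) absolutely_integrable_on {0<..}"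
    by (intro set_integrable_cong) (auto simp: norm_divide norm_of_real_powr exp_minus field_simps)
  finally show ?thesis
    by (subst set_integrable_lborel_iff_absolutely_integrable) 
       (auto intro!: measurable_real_mellin_integrand)
qed

lemma
  assumes "0 < Re s"
  shows mellin_integrable_exp: "mellin_integrable (\<lambda>x. exp (- x)) s"
    and mellin_exp: "mellin (\<lambda>x. exp (- x)) s = Gamma s"
proof -
  show int: "mellin_integrable (\<lambda>x. exp (- x)) s"
    by (rule mellin_integrable_bound[OF _ set_integrable_Gamma]) (use assms in auto)
  have "((\<lambda>x. of_real x powr (s - 1) * complex_of_real (exp (- x))) has_integral Gamma s) {0<..}"
    using Gamma_integral_complex'[OF assms] by (simp add: exp_minus field_simps)
  then show "mellin (\<lambda>x. exp (- x)) s = Gamma s"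
    using set_borel_integral_eq_integral(2)[OF int[unfolded mellin_integrable_def]]
    unfolding mellin_def by (simp add: integral_unique)
qed

text \<open>Boundedness near 0 accounts for 0 < \<sigma>, decay like 1/x at infinity for \<sigma> <
  1. This majorant serves \<open>planck\<close>, \<open>cauchy_kernel\<close> and, up to a factor 2,
  the partial sums of the cosecant expansion.\<close>

lemma set_integrable_min:
  fixes \<sigma> :: real
  assumes "0 < \<sigma>" "\<sigma> < 1"
  shows "set_integrable lborel {0<..} (\<lambda>x. x powr (\<sigma> - 1) * min 1 (1 / x))"
proof -
  have "(\<lambda>x. x powr (\<sigma> - 1)) absolutely_integrable_on {0<..1}"
    using assms by (subst absolutely_integrable_on_iff_nonneg) (auto intro!: integrable_on_powr_from_0')
  then have "set_integrable lborel {0<..1} (\<lambda>x::real. x powr (\<sigma> - 1))"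
    by (subst set_integrable_lborel_iff_absolutely_integrable) (auto simp: set_borel_measurable_def)
  also have "?this \<longleftrightarrow> set_integrable lborel {0<..1} (\<lambda>x. x powr (\<sigma> - 1) * min 1 (1 / x))"
    by (intro set_integrable_cong) (auto simp: min_def field_simps)
  finally have 1: \<dots> .
  have "(\<lambda>x. x powr (\<sigma> - 2)) absolutely_integrable_on {1..}"
    using assms has_integral_powr_to_inf[of "\<sigma> - 2" 1]
    by (subst absolutely_integrable_on_iff_nonneg) (auto simp: has_integral_iff)
  then have "set_integrable lborel {1..} (\<lambda>x::real. x powr (\<sigma> - 2))"
    by (subst set_integrable_lborel_iff_absolutely_integrable) (auto simp: set_borel_measurable_def)
  also have "?this \<longleftrightarrow> set_integrable lborel {1..} (\<lambda>x. x powr (\<sigma> - 1) * min 1 (1 / x))"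
    by (intro set_integrable_cong) (auto simp: min_def field_simps powr_diff power2_eq_square)
  finally have "set_integrable lborel ({0<..1} \<union> {1..}) (\<lambda>x. x powr (\<sigma> - 1) * min 1 (1 / x))"
    by (intro set_integrable_Un 1) auto
  also have "{0<..1} \<union> {1..} = {0::real<..}" by auto
  finally show ?thesis .
qed

subsection \<open>The eta function as a Mellin transform\<close>

lemma eta_partial_conv_sum: "eta_partial n s = (\<Sum>k<n. (-1) ^ k / of_nat (Suc k) powr s)"
  unfolding eta_partial_def
  by (rule sum.reindex_bij_witness[of _ Suc "\<lambda>k. k - 1"]) auto

lemma dirichlet_eta_eqI: "(\<lambda>n. eta_partial n s) \<longlonglongrightarrow> l \<Longrightarrow> dirichlet_eta s = l"
  unfolding dirichlet_eta_def eta_partial_conv_sum sums_def[symmetric] by (rule sums_unique[symmetric])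

text \<open>The Fermi-Dirac kernel: for x > 0 its geometric expansion is the alternating series of
  the exponentials exp(-kx), whose Mellin transforms are the terms of \<Gamma>(s) \<eta>(s).\<close>

definition fermi :: "real \<Rightarrow> real" where
  "fermi x = 1 / (exp x + 1)"

lemma measurable_fermi [measurable]: "fermi \<in> borel_measurable borel"
  unfolding fermi_def by measurable

lemma fermi_nonneg: "0 \<le> fermi x"
  and fermi_le_1: "fermi x \<le> 1"
  and fermi_le_exp: "fermi x \<le> exp (- x)"
  using add_pos_pos[OF exp_gt_zero[of x] zero_less_one] by (auto simp: fermi_def exp_minus divide_simps)

text \<open>A finite geometric sum of ratio -exp(-x). Its exact remainder is kept because the
  behaviour of the partial sums at a zero of \<eta> is read off from it.\<close>

lemma alternating_exp_sum:
  "(\<Sum>k<n. (-1) ^ k * exp (- (real (Suc k) * x))) = fermi x - (-1) ^ n * exp (- (real n * x)) * fermi x"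
proof (induction n)
  case (Suc n)
  have q: "exp (- (real (Suc n) * x)) = exp (- (real n * x)) * exp (- x)"
    by (simp add: algebra_simps flip: exp_add)
  moreover have "exp (- x) = fermi x + exp (- x) * fermi x"
    using add_pos_pos[of "exp x" 1] unfolding fermi_def exp_minus
    by (simp add: divide_simps)
  ultimately have "exp (- (real (Suc n) * x))
      = exp (- (real n * x)) * (fermi x + exp (- x) * fermi x)" by simp
  also have "\<dots> = exp (- (real n * x)) * fermi x + exp (- (real n * x)) * exp (- x) * fermi x"
    by (simp add: algebra_simps)
  also note q[symmetric]
  finally have "exp (- (real (Suc n) * x))
      = exp (- (real n * x)) * fermi x + exp (- (real (Suc n) * x)) * fermi x" .
  then show ?case unfolding sum.lessThan_Suc Suc
    by (cases "even n") (auto simp: algebra_simps)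
qed simp

text \<open>The Mellin transform of the geometric remainder after substituting x/n for x, with sign
  and power of n removed. In this form the integrand converges as n grows.\<close>

definition eta_rem :: "nat \<Rightarrow> complex \<Rightarrow> complex" where
  "eta_rem n s = mellin (\<lambda>x. exp (- x) * fermi (x / real n)) s"

lemma mellin_integrable_fermi: "0 < Re s \<Longrightarrow> mellin_integrable fermi s"
  using fermi_le_exp fermi_nonneg
  by (intro mellin_integrable_bound[OF _ set_integrable_Gamma]) auto

lemma mellin_eta_partial:
  assumes "0 < Re s" "0 < n"
  shows "Gamma s * eta_partial n s = mellin fermi s - (-1) ^ n * of_nat n powr (- s) * eta_rem n s"
proof -
  have exp: "mellin (\<lambda>x. exp (- (real (Suc k) * x))) s = of_nat (Suc k) powr (- s) * Gamma s"
      and expi: "mellin_integrable (\<lambda>x. exp (- (real (Suc k) * x))) s" for k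
    using mellin_scale[of "real (Suc k)" "\<lambda>x. exp (- x)" s] assms(1)
      mellin_integrable_scale[of "real (Suc k)" "\<lambda>x. exp (- x)" s]
    by (simp_all add: mellin_exp mellin_integrable_exp)
  have "Gamma s * eta_partial n s = (\<Sum>k<n. mellin (\<lambda>x. (-1) ^ k * exp (- (real (Suc k) * x))) s)"
    unfolding eta_partial_conv_sum mellin_cmult exp sum_distrib_left
    by (simp add: powr_minus field_simps)
  also have "\<dots> = mellin (\<lambda>x. \<Sum>k<n. (-1) ^ k * exp (- (real (Suc k) * x))) s"
    by (intro mellin_sum[symmetric] mellin_integrable_cmult expi)
  also have "\<dots> = mellin (\<lambda>x. fermi x - (-1) ^ n * (exp (- (real n * x)) * fermi x)) s"
    by (simp only: alternating_exp_sum mult.assoc)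
  also have "\<dots> = mellin fermi s - mellin (\<lambda>x. (-1) ^ n * (exp (- (real n * x)) * fermi x)) s"
  proof (intro mellin_diff mellin_integrable_cmult mellin_integrable_fermi assms)
    have "exp (- (real n * x)) * fermi x \<le> exp (- x)" if "0 < x" for x
      using mult_mono[of "exp (- (real n * x))" 1 "fermi x" "exp (- x)"] that fermi_nonneg[of x] fermi_le_exp[of x]
      by simp
    then show "mellin_integrable (\<lambda>x. exp (- (real n * x)) * fermi x) s"
      using assms(1) fermi_nonneg
      by (intro mellin_integrable_bound[OF _ set_integrable_Gamma[OF assms(1)]]) auto
  qed
  \<comment> \<open>Writing \<open>fermi x\<close> as \<open>fermi ((real n * x) / real n)\<close>
    makes the remainder a function of n x alone, so that \<open>mellin_scale\<close> extracts the
    power of n.\<close>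
  also have "mellin (\<lambda>x. (-1) ^ n * (exp (- (real n * x)) * fermi x)) s
      = (-1) ^ n * mellin (\<lambda>x. exp (- (real n * x)) * fermi ((real n * x) / real n)) s"
    using assms(2) by (simp add: mellin_cmult)
  also have "mellin (\<lambda>x. exp (- (real n * x)) * fermi ((real n * x) / real n)) s
      = of_nat n powr (- s) * eta_rem n s"
    using mellin_scale[of "real n" "\<lambda>x. exp (- x) * fermi (x / real n)" s] assms(2)
    by (simp add: eta_rem_def)
  finally show ?thesis by simp
qed

lemma eta_rem_bound: "\<bar>exp (- x) * fermi (x / real n)\<bar> \<le> exp (- x)"
  using fermi_nonneg[of "x / real n"] fermi_le_1[of "x / real n"] by simp

text \<open>The integrand tends to exp(-x) times \<open>fermi 0\<close>, and \<open>fermi 0\<close>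
  = 1/2 is the constant of the remainder asymptotics.\<close>

lemma eta_rem_LIMSEQ:
  assumes "0 < Re s"
  shows "(\<lambda>n. eta_rem n s) \<longlonglongrightarrow> Gamma s / 2"
proof -
  have "(\<lambda>n. eta_rem n s) \<longlonglongrightarrow> mellin (\<lambda>x. exp (- x) * fermi 0) s"
    unfolding eta_rem_def
  proof (rule mellin_LIMSEQ[OF _ _ set_integrable_Gamma[OF assms]])
    fix x :: real
    have "isCont fermi 0"
      unfolding fermi_def by (auto intro!: continuous_intros)
    moreover have "(\<lambda>n. x / real n) \<longlonglongrightarrow> 0"
      by (rule lim_const_over_n)
    ultimately have "(\<lambda>n. fermi (x / real n)) \<longlonglongrightarrow> fermi 0"
      by (rule isCont_tendsto_compose)
    then show "(\<lambda>n. exp (- x) * fermi (x / real n)) \<longlonglongrightarrow> exp (- x) * fermi 0"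
      by (rule tendsto_mult_left)
  qed (use eta_rem_bound in auto)
  also have "(\<lambda>x. exp (- x) * fermi 0) = (\<lambda>x. 1 / 2 * exp (- x))"
    by (simp add: fermi_def)
  also have "mellin \<dots> s = Gamma s / 2"
    by (simp only: mellin_cmult mellin_exp[OF assms]) simp
  finally show ?thesis .
qed

text \<open>A bound free of n and of Im s, which gives locally uniform convergence of the partial
  sums.\<close>

lemma norm_eta_rem_le:
  assumes "0 < Re s"
  shows "norm (eta_rem n s) \<le> Gamma (Re s)"
proof -
  have le: "norm (eta_rem n s) \<le> (LINT x:{0<..}|lborel. x powr (Re s - 1) * exp (- x))"
    unfolding eta_rem_def
    by (intro norm_mellin_le set_integrable_Gamma eta_rem_bound assms) auto
  have "complex_of_real (LINT x:{0<..}|lborel. x powr (Re s - 1) * exp (- x))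
      = (LINT x:{0<..}|lborel. complex_of_real (x powr (Re s - 1) * exp (- x)))"
    by (rule set_integral_complex_of_real[symmetric])
  also have "\<dots> = mellin (\<lambda>x. exp (- x)) (of_real (Re s))"
    unfolding mellin_def
  proof (rule set_lebesgue_integral_cong)
    show "\<forall>x. x \<in> {0<..} \<longrightarrow> complex_of_real (x powr (Re s - 1) * exp (- x)) =
        of_real x powr (of_real (Re s) - 1) * of_real (exp (- x))"
      using powr_of_real[of _ "Re s - 1"] by auto
  qed simp
  also have "\<dots> = of_real (Gamma (Re s))"
    using assms by (simp add: mellin_exp Gamma_complex_of_real)
  finally have "(LINT x:{0<..}|lborel. x powr (Re s - 1) * exp (- x)) = Gamma (Re s)"
    by (simp only: of_real_eq_iff)
  with le show ?thesis by simp
qed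

lemma of_nat_powr_minus_tendsto_0:
  assumes "0 < Re s"
  shows "(\<lambda>n. complex_of_nat n powr (- s)) \<longlonglongrightarrow> 0"
proof (rule tendsto_norm_zero_cancel)
  have "(\<lambda>n. real n powr (- Re s)) \<longlonglongrightarrow> 0"
    by (intro tendsto_neg_powr filterlim_real_sequentially) (use assms in auto)
  moreover have "norm (complex_of_nat n powr (- s)) = real n powr (- Re s)" for n
    by (subst norm_powr_real_powr) auto
  ultimately show "(\<lambda>n. norm (complex_of_nat n powr (- s))) \<longlonglongrightarrow> 0" by simp
qed

lemma eta_remainder_tendsto_0:
  assumes "0 < Re s"
  shows "(\<lambda>n. (-1) ^ n * of_nat n powr (- s) * eta_rem n s) \<longlonglongrightarrow> 0"
proof -
  have "(\<lambda>n. of_nat n powr (- s) * eta_rem n s) \<longlonglongrightarrow> 0 * (Gamma s / 2)"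
    by (intro tendsto_mult of_nat_powr_minus_tendsto_0 eta_rem_LIMSEQ assms)
  then have "(\<lambda>n. norm (of_nat n powr (- s) * eta_rem n s)) \<longlonglongrightarrow> 0"
    by (simp add: tendsto_norm_zero)
  then show ?thesis
    by - (rule tendsto_norm_zero_cancel, simp add: norm_mult norm_power)
qed

lemma Gamma_nonzero_Re: "0 < Re s \<Longrightarrow> Gamma s \<noteq> 0"
  by (auto simp: Gamma_eq_zero_iff elim!: nonpos_Ints_cases)

text \<open>Since the exact remainder tends to 0, the conditional convergence of the series and the
  value of its sum are obtained together.\<close>

lemma eta_partial_LIMSEQ:
  assumes "0 < Re s"
  shows "(\<lambda>n. eta_partial n s) \<longlonglongrightarrow> mellin fermi s / Gamma s"
proof -
  have "(\<lambda>n. (mellin fermi s - (-1) ^ n * of_nat n powr (- s) * eta_rem n s) / Gamma s)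
      \<longlonglongrightarrow> (mellin fermi s - 0) / Gamma s"
    by (intro tendsto_intros eta_remainder_tendsto_0 assms Gamma_nonzero_Re)
  moreover have "\<forall>\<^sub>F n in sequentially. (mellin fermi s - (-1) ^ n * of_nat n powr (- s) * eta_rem n s) / Gamma s
      = eta_partial n s"
    using eventually_gt_at_top[of 0]
    by eventually_elim (use mellin_eta_partial[of s] Gamma_nonzero_Re[OF assms] assms in \<open>simp add: field_simps\<close>)
  ultimately show ?thesis by (simp add: Lim_transform_eventually)
qed

lemma mellin_fermi: "0 < Re s \<Longrightarrow> mellin fermi s = Gamma s * dirichlet_eta s"
  using dirichlet_eta_eqI[OF eta_partial_LIMSEQ] Gamma_nonzero_Re by simp

lemma dirichlet_eta_LIMSEQ: "0 < Re s \<Longrightarrow> (\<lambda>n. eta_partial n s) \<longlonglongrightarrow> dirichlet_eta s"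
  using dirichlet_eta_eqI[OF eta_partial_LIMSEQ] eta_partial_LIMSEQ by simp

lemma eta_partial_eq:
  assumes "0 < Re s" "0 < n"
  shows "eta_partial n s = dirichlet_eta s - (-1) ^ n * of_nat n powr (- s) * (eta_rem n s / Gamma s)"
  using mellin_eta_partial[OF assms] Gamma_nonzero_Re[OF assms(1)] mellin_fermi[OF assms(1)]
  by (simp add: field_simps)

section \<open>Holomorphy of \<eta> and isolation of its zeros\<close>

lemma holomorphic_dirichlet_eta: "dirichlet_eta holomorphic_on {s. 0 < Re s}"
proof (rule holomorphic_uniform_sequence)
  show "open {s. 0 < Re s}" by (rule open_halfspace_Re_gt)
  show "(\<lambda>s. eta_partial n s) holomorphic_on {s. 0 < Re s}" for n
    unfolding eta_partial_conv_sum
    by (intro holomorphic_intros) (auto simp del: of_nat_Suc)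
  fix s assume s: "s \<in> {s. 0 < Re s}"
  define d where "d = Re s / 2"
  have d: "0 < d" using s by (simp add: d_def)
  have ge: "d \<le> Re z" if "z \<in> cball s d" for z
    using abs_Re_le_cmod[of "s - z"] that by (auto simp: d_def dist_norm)
  \<comment> \<open>For every n > 0 the error at z is at most n^(-d) times
    \<open>norm (g z)\<close>: the radius d keeps Re z \<ge> d on the disc. There \<open>g\<close>
    is continuous, hence bounded by compactness.\<close>
  define g where "g z = Gamma (complex_of_real (Re z)) / Gamma z" for z
  have nonpos: "z \<notin> \<int>\<^sub>\<le>\<^sub>0" "complex_of_real (Re z) \<notin> \<int>\<^sub>\<le>\<^sub>0" if "z \<in> cball s d" for z
    using ge[OF that] d by (force elim!: nonpos_Ints_cases dest: arg_cong[of _ _ Re])+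
  have "continuous_on (cball s d) (\<lambda>z. Gamma (complex_of_real (Re z)))"
    by (rule continuous_on_compose2[OF continuous_on_Gamma[of "- \<int>\<^sub>\<le>\<^sub>0"]])
       (use nonpos in \<open>auto intro!: continuous_intros\<close>)
  moreover have "continuous_on (cball s d) Gamma"
    using nonpos by (intro continuous_on_Gamma) auto
  ultimately have "continuous_on (cball s d) g"
    unfolding g_def using nonpos by (intro continuous_on_divide) (auto simp: Gamma_eq_zero_iff)
  then have "bounded (g ` cball s d)"
    by (intro compact_imp_bounded compact_continuous_image compact_cball)
  then obtain K where K: "\<And>z. z \<in> cball s d \<Longrightarrow> norm (g z) \<le> K"
    unfolding bounded_iff by blast
  have "uniform_limit (cball s d) eta_partial dirichlet_eta sequentially"
  proof (rule uniform_limitI)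
    fix e :: real assume "0 < e"
    have "(\<lambda>n. real n powr (- d) * K) \<longlonglongrightarrow> 0 * K"
      by (intro tendsto_intros tendsto_neg_powr filterlim_real_sequentially) (use d in auto)
    then have "\<forall>\<^sub>F n in sequentially. real n powr (- d) * K < e"
      using \<open>0 < e\<close> by (intro order_tendstoD) auto
    then show "\<forall>\<^sub>F n in sequentially. \<forall>z\<in>cball s d. dist (eta_partial n z) (dirichlet_eta z) < e"
      using eventually_gt_at_top[of 0]
    proof eventually_elim
      case (elim n)
      show ?case
      proof
        fix z assume z: "z \<in> cball s d"
        have pos: "0 < Re z" using ge[OF z] d by simp
        have "dist (eta_partial n z) (dirichlet_eta z)
            = norm (complex_of_nat n powr (- z)) * (norm (eta_rem n z) / norm (Gamma z))"
          using eta_partial_eq[OF pos] elim by (simp add: dist_norm norm_mult norm_divide norm_power)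
        also have "norm (complex_of_nat n powr (- z)) = real n powr (- Re z)"
          by (subst norm_powr_real_powr) auto
        also have "real n powr (- Re z) * (norm (eta_rem n z) / norm (Gamma z)) \<le> real n powr (- d) * K"
        proof (intro mult_mono)
          show "real n powr (- Re z) \<le> real n powr (- d)"
            using ge[OF z] elim by (intro powr_mono) auto
          have "norm (eta_rem n z) / norm (Gamma z) \<le> norm (g z)"
            using norm_eta_rem_le[OF pos, of n] pos
            by (auto simp: g_def norm_divide Gamma_complex_of_real Gamma_real_pos intro!: divide_right_mono)
          then show "norm (eta_rem n z) / norm (Gamma z) \<le> K"
            using K[OF z] by simp
        qed auto
        finally show "dist (eta_partial n z) (dirichlet_eta z) < e" using elim by simp
      qed
    qed
  qed
  moreover have "cball s d \<subseteq> {s. 0 < Re s}" using ge d by force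
  ultimately show "\<exists>d>0. cball s d \<subseteq> {s. 0 < Re s} \<and> uniform_limit (cball s d) eta_partial dirichlet_eta sequentially"
    using d by blast
qed

text \<open>The point at which \<eta> is seen not to vanish identically, as isolation of its zeros
  requires.\<close>

lemma dirichlet_eta_1: "dirichlet_eta 1 = of_real (ln 2)"
proof -
  have "(\<lambda>k. complex_of_real ((-1) ^ k / real (Suc k))) sums of_real (ln 2)"
    using alternating_harmonic_series_sums by (simp only: sums_of_real_iff)
  then show ?thesis by (simp add: dirichlet_eta_def sums_iff)
qed

lemma dirichlet_eta_isolated_zero:
  assumes "0 < Re s" "dirichlet_eta s = 0"
  shows "\<forall>\<^sub>F z in at s. dirichlet_eta z \<noteq> 0"
proof -
  have conn: "connected {s. 0 < Re s}"
    by (intro convex_connected convex_halfspace_Re_gt)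
  obtain r where "0 < r" "\<And>z. z \<in> ball s r - {s} \<Longrightarrow> dirichlet_eta z \<noteq> 0"
  proof (rule isolated_zeros[OF holomorphic_dirichlet_eta open_halfspace_Re_gt conn])
    show "s \<in> {s. 0 < Re s}" "dirichlet_eta s = 0" "(1 :: complex) \<in> {s. 0 < Re s}"
      using assms by simp_all
    show "dirichlet_eta 1 \<noteq> 0" by (simp add: dirichlet_eta_1)
  qed blast
  then have "\<forall>z. z \<noteq> s \<and> dist z s < r \<longrightarrow> dirichlet_eta z \<noteq> 0"
    by (simp add: dist_commute)
  with \<open>0 < r\<close> show ?thesis
    unfolding eventually_at by (intro exI[of _ r]) simp
qed

text \<open>
  Subtracting the pole makes the Bose kernel \<open>1 / (exp x - 1)\<close> integrable against
  \<open>x powr (s - 1)\<close> for \<open>0 < Re s < 1\<close>, at the price of losing convergence for \<open>Re s \<ge> 1\<close>.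
\<close>

definition planck :: "real \<Rightarrow> real" where
  "planck x = 1 / (exp x - 1) - 1 / x"

lemma measurable_planck [measurable]: "planck \<in> borel_measurable borel"
  unfolding planck_def by measurable

text \<open>The inequality 1 + x \<le> exp x gives the bound 1/x; its instance at -x, multiplied by
  exp x, gives the bound 1.\<close>

lemma abs_planck_le:
  assumes "0 < x"
  shows "\<bar>planck x\<bar> \<le> min 1 (1 / x)"
proof -
  have e: "x \<le> exp x - 1" using exp_ge_add_one_self[of x] by linarith
  have "(1 - x) * exp x \<le> exp (- x) * exp x"
    using exp_ge_add_one_self[of "- x"] by (intro mult_right_mono) auto
  then have "(1 - x) * exp x \<le> 1" by (simp flip: exp_add)
  then have "1 / x - 1 / (exp x - 1) \<le> 1"
    using e assms by (simp add: divide_simps) (simp add: algebra_simps)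
  moreover have "1 / (exp x - 1) \<le> 1 / x" "0 \<le> 1 / (exp x - 1)"
    using e assms by (auto simp: divide_simps)
  ultimately show ?thesis by (simp add: planck_def)
qed

lemma mellin_integrable_planck:
  assumes "0 < Re s" "Re s < 1"
  shows "mellin_integrable planck s"
  by (rule mellin_integrable_bound[OF _ set_integrable_min]) (use assms abs_planck_le in auto)

text \<open>With q = exp x both are partial fractions over q^2 - 1 = (q - 1)(q + 1). The poles 1/x
  cancel in the first identity and combine to a single 1/x in the second.\<close>

lemma
  assumes "0 < x"
  shows fermi_eq_planck: "fermi x = planck x - 2 * planck (2 * x)"
    and csch_eq_planck: "1 / x - 1 / sinh x = 2 * planck (2 * x) - 2 * planck x"
proof -
  define q where "q = exp x"
  have q: "q > 1" using assms by (simp add: q_def)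
  have q2: "exp (2 * x) = q * q" by (simp add: q_def flip: exp_add)
  have nz: "q * q - 1 \<noteq> 0" using q by (metis less_1_mult less_irrefl right_minus_eq)
  have fac: "q * q - 1 = (q - 1) * (q + 1)" by (simp add: algebra_simps)
  have "1 / (q + 1) = 1 / (q - 1) - 2 * (1 / (q * q - 1))"
    unfolding fac using q by (simp add: divide_simps)
  then show "fermi x = planck x - 2 * planck (2 * x)"
    by (simp add: fermi_def planck_def q2 flip: q_def)
  have sinh: "sinh x = (q * q - 1) / (2 * q)"
    using q by (simp add: sinh_field_def exp_minus field_simps flip: q_def)
  then have "1 / sinh x = 2 * (1 / (q - 1)) - 2 * (1 / (q * q - 1))"
    unfolding sinh fac using q by (simp add: divide_simps)
  then show "1 / x - 1 / sinh x = 2 * planck (2 * x) - 2 * planck x"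
    by (simp add: planck_def q2 flip: q_def)
qed

text \<open>Scaling by 2 makes both transforms elementary multiples of
  \<open>mellin planck s\<close>, the common quantity that the functional equation
  eliminates.\<close>

lemma
  assumes "0 < Re s" "Re s < 1"
  shows mellin_fermi_planck: "mellin fermi s = (1 - 2 * 2 powr (- s)) * mellin planck s"
    and mellin_csch_planck:
      "mellin (\<lambda>x. 1 / x - 1 / sinh x) s = (2 * 2 powr (- s) - 2) * mellin planck s"
proof -
  note int = mellin_integrable_planck[OF assms]
  have int2: "mellin_integrable (\<lambda>x. planck (2 * x)) s"
    using int by (simp add: mellin_integrable_scale)
  have eq2: "mellin (\<lambda>x. planck (2 * x)) s = 2 powr (- s) * mellin planck s"
    using mellin_scale[of 2 planck s] by simp
  have "mellin fermi s = mellin (\<lambda>x. planck x - 2 * planck (2 * x)) s"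
    by (intro mellin_cong fermi_eq_planck)
  also have "\<dots> = (1 - 2 * 2 powr (- s)) * mellin planck s"
    by (simp add: mellin_diff[OF int mellin_integrable_cmult[OF int2]] mellin_cmult eq2) (simp add: algebra_simps)
  finally show "mellin fermi s = (1 - 2 * 2 powr (- s)) * mellin planck s" .
  have "mellin (\<lambda>x. 1 / x - 1 / sinh x) s = mellin (\<lambda>x. 2 * planck (2 * x) - 2 * planck x) s"
    by (intro mellin_cong csch_eq_planck)
  also have "\<dots> = (2 * 2 powr (- s) - 2) * mellin planck s"
    by (simp add: mellin_diff[OF mellin_integrable_cmult[OF int2] mellin_integrable_cmult[OF int]] mellin_cmult eq2)
       (simp add: algebra_simps)
  finally show "mellin (\<lambda>x. 1 / x - 1 / sinh x) s = (2 * 2 powr (- s) - 2) * mellin planck s" .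
qed

subsection \<open>Partial fractions of the cosecant\<close>

text \<open>Differentiate the reflection formula for \<open>rGamma z * rGamma (1 - z)\<close>; the
  logarithmic derivative of the product is the Digamma difference.\<close>

lemma Digamma_reflection:
  fixes z :: complex
  assumes "z \<notin> \<int>"
  shows "sin (of_real pi * z) * (Digamma (1 - z) - Digamma z) = of_real pi * cos (of_real pi * z)"
proof -
  have z: "z \<notin> \<int>\<^sub>\<le>\<^sub>0" "1 - z \<notin> \<int>\<^sub>\<le>\<^sub>0"
    using assms Ints_diff[of 1 "1 - z"] by (auto dest: nonpos_Ints_subset_Ints[THEN subsetD] nonpos_Ints_Int)
  have "((\<lambda>z. rGamma z * rGamma (1 - z)) has_field_derivative
      (rGamma z * rGamma (1 - z) * (Digamma (1 - z) - Digamma z))) (at z)"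
    using z by (auto intro!: derivative_eq_intros simp: algebra_simps)
  moreover have "((\<lambda>z. sin (of_real pi * z) / of_real pi) has_field_derivative cos (of_real pi * z)) (at z)"
    by (auto intro!: derivative_eq_intros)
  moreover have "(\<lambda>z::complex. rGamma z * rGamma (1 - z)) = (\<lambda>z. sin (of_real pi * z) / of_real pi)"
    by (intro ext rGamma_reflection_complex)
  ultimately have "rGamma z * rGamma (1 - z) * (Digamma (1 - z) - Digamma z) = cos (of_real pi * z)"
    by (auto intro: DERIV_unique)
  then show ?thesis
    by (simp add: rGamma_reflection_complex field_simps)
qed

text \<open>The terms ln m in the two limits for Digamma cancel in the difference.\<close>

lemma Digamma_diff_LIMSEQ:
  fixes z :: complex
  assumes "z \<notin> \<int>"
  shows "(\<lambda>m. \<Sum>n<m. inverse (z + of_nat n) - inverse (1 - z + of_nat n)) \<longlonglongrightarrow> Digamma (1 - z) - Digamma z"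
proof -
  have nz: "z \<noteq> 0" "1 - z \<noteq> 0" using assms by auto
  show ?thesis
    using tendsto_diff[OF Digamma_LIMSEQ[OF nz(2)] Digamma_LIMSEQ[OF nz(1)]]
    by (simp add: sum_subtractf)
qed

text \<open>Twice the even-indexed \<open>u\<close> minus all \<open>u\<close> alternates in sign,
  and likewise for \<open>v\<close> with odd indices. Shifting \<open>u\<close> by one pairs the two
  poles at equal distance from 0 and leaves the boundary terms \<open>u 0\<close> and
  \<open>u (2 * N)\<close>.\<close>

lemma alternating_sum_rearrange:
  fixes u v :: "nat \<Rightarrow> complex"
  shows "(\<Sum>n<N. 2 * u (2 * n) - 2 * v (2 * n + 1)) - (\<Sum>n<2 * N. u n - v n)
    = u 0 - u (2 * N) - (\<Sum>k<2 * N. (-1) ^ k * (u (Suc k) - v k))"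
  by (induction N) (simp_all add: algebra_simps)

text \<open>This is cot w - cot 2w = 1 / sin 2w at w = \<pi> z / 2, with both cotangents expressed
  through Digamma reflection, at z/2 and at z.\<close>

lemma cosecant_LIMSEQ:
  fixes z :: complex
  assumes "z \<notin> \<int>"
  shows "(\<lambda>N. inverse z - inverse (z + of_nat (2 * N))
      - (\<Sum>k<2 * N. (-1) ^ k * (inverse (z + of_nat (Suc k)) - inverse (1 - z + of_nat k))))
    \<longlonglongrightarrow> of_real pi / sin (of_real pi * z)"
proof -
  define u where "u n = inverse (z + of_nat n)" for n
  define v where "v n = inverse (1 - z + of_nat n)" for n
  have half: "z / 2 \<notin> \<int>"
  proof
    assume "z / 2 \<in> \<int>"
    then have "2 * (z / 2) \<in> \<int>" by (intro Ints_mult) auto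
    with assms show False by simp
  qed
  define w where "w = of_real pi * z / 2"
  have sin2: "sin (2 * w) \<noteq> 0"
    using assms by (auto simp: w_def sin_eq_0 field_simps)
  then have nz: "sin w \<noteq> 0" "cos w \<noteq> 0" by (auto simp: sin_double)
  have "(Digamma (1 - z / 2) - Digamma (z / 2)) = of_real pi * cos w / sin w"
    using Digamma_reflection[OF half] nz by (simp add: w_def field_simps)
  moreover have "(Digamma (1 - z) - Digamma z) = of_real pi * cos (2 * w) / sin (2 * w)"
    using Digamma_reflection[OF assms] sin2 by (simp add: w_def field_simps)
  moreover have "of_real pi * cos w / sin w - of_real pi * cos (2 * w) / sin (2 * w) = of_real pi / sin (2 * w)"
    using nz by (simp add: sin_double cos_double_cos divide_simps) (simp add: power2_eq_square algebra_simps)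
  ultimately have lim: "(Digamma (1 - z / 2) - Digamma (z / 2)) - (Digamma (1 - z) - Digamma z)
      = of_real pi / sin (of_real pi * z)"
    by (simp add: w_def)
  \<comment> \<open>Halving z doubles the spacing of the poles, so only even indices of
    \<open>u\<close> and odd indices of \<open>v\<close> occur.\<close>
  have "inverse (z / 2 + of_nat n) - inverse (1 - z / 2 + of_nat n) = 2 * u (2 * n) - 2 * v (2 * n + 1)" for n
  proof -
    have "z / 2 + of_nat n = (z + of_nat (2 * n)) / 2" "1 - z / 2 + of_nat n = (1 - z + of_nat (2 * n + 1)) / 2"
      by (simp_all add: field_simps)
    then show ?thesis by (simp only: u_def v_def inverse_divide) (simp only: divide_inverse)
  qed
  then have "(\<lambda>N. \<Sum>n<N. 2 * u (2 * n) - 2 * v (2 * n + 1)) \<longlonglongrightarrow> Digamma (1 - z / 2) - Digamma (z / 2)"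
    using Digamma_diff_LIMSEQ[OF half] by simp
  moreover have "(\<lambda>N. \<Sum>n<2 * N. u n - v n) \<longlonglongrightarrow> Digamma (1 - z) - Digamma z"
    using filterlim_compose[OF Digamma_diff_LIMSEQ[OF assms] mult_nat_left_at_top[of 2]]
    by (simp add: u_def v_def)
  ultimately have "(\<lambda>N. (\<Sum>n<N. 2 * u (2 * n) - 2 * v (2 * n + 1)) - (\<Sum>n<2 * N. u n - v n))
      \<longlonglongrightarrow> of_real pi / sin (of_real pi * z)"
    unfolding lim[symmetric] by (rule tendsto_diff)
  then show ?thesis
    unfolding alternating_sum_rearrange by (simp add: u_def v_def)
qed

text \<open>The sum of 1/(x - i k \<pi>) and 1/(x + i k \<pi>), a conjugate pair of poles of 1/sinh
  up to sign.\<close>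

definition pole_pair :: "nat \<Rightarrow> real \<Rightarrow> real" where
  "pole_pair k x = 2 * x / (x\<^sup>2 + (real k * pi)\<^sup>2)"

lemma csch_LIMSEQ:
  assumes "0 < x"
  shows "(\<lambda>N. \<Sum>k<2 * N. (-1) ^ k * pole_pair (Suc k) x) \<longlonglongrightarrow> 1 / x - 1 / sinh x"
proof -
  \<comment> \<open>Chosen so that sin(\<pi> z) = i sinh x. Each pair then equals -i \<pi> times a
    real number, and the final multiplication by i/\<pi> returns to the reals.\<close>
  define z where "z = \<i> * of_real x / of_real pi"
  have z: "z \<notin> \<int>"
    using assms by (auto simp: z_def elim!: Ints_cases dest: arg_cong[of _ _ Im])
  have pair: "inverse (z + of_nat (Suc k)) - inverse (1 - z + of_nat k)
      = - \<i> * of_real pi * of_real (pole_pair (Suc k) x)" for k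
  proof -
    define m where "m = real (Suc k)"
    have m: "m > 0" by (simp add: m_def)
    have nz: "of_real m + z \<noteq> 0" "of_real m - z \<noteq> 0"
      using m by (auto simp: z_def complex_eq_iff)
    have pos: "x\<^sup>2 + (m * pi)\<^sup>2 \<noteq> 0" using assms by (simp add: sum_power2_eq_zero_iff)
    have "inverse (z + of_nat (Suc k)) - inverse (1 - z + of_nat k) = inverse (of_real m + z) - inverse (of_real m - z)"
      by (simp add: m_def algebra_simps)
    also have "\<dots> = - 2 * z / ((of_real m + z) * (of_real m - z))"
      using nz by (simp add: divide_simps)
    also have "(of_real m + z) * (of_real m - z) = of_real ((x\<^sup>2 + (m * pi)\<^sup>2) / pi\<^sup>2)"
      by (simp add: z_def field_simps power2_eq_square)
    also have "- 2 * z / \<dots> = - \<i> * of_real pi * of_real (pole_pair (Suc k) x)"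
      using pos by (simp add: z_def pole_pair_def m_def[symmetric] field_simps power2_eq_square del: of_nat_Suc)
    finally show ?thesis .
  qed
  have "(\<lambda>N. inverse z - inverse (z + of_nat (2 * N))) \<longlonglongrightarrow> inverse z - 0"
  proof (intro tendsto_diff tendsto_const)
    have "filterlim (\<lambda>N. z + complex_of_nat (2 * N)) at_infinity sequentially"
      by (rule tendsto_add_filterlim_at_infinity[OF tendsto_const])
         (rule filterlim_compose[OF tendsto_of_nat mult_nat_left_at_top], simp)
    then show "(\<lambda>N. inverse (z + of_nat (2 * N))) \<longlonglongrightarrow> 0"
      by (rule tendsto_inverse_0[THEN filterlim_compose])
  qed
  from tendsto_diff[OF this cosecant_LIMSEQ[OF z]]
  have "(\<lambda>N. - \<i> * of_real pi * of_real (\<Sum>k<2 * N. (-1) ^ k * pole_pair (Suc k) x))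
      \<longlonglongrightarrow> inverse z - of_real pi / sin (of_real pi * z)"
    unfolding pair by (simp add: sum_distrib_left mult_ac sum_negf)
  also have "sin (of_real pi * z) = \<i> * of_real (sinh x)"
  proof -
    have "of_real pi * z = \<i> * of_real x" by (simp add: z_def)
    then show ?thesis
      by (simp add: sin_i_times sinh_field_def exp_of_real exp_minus)
  qed
  also have "inverse z - of_real pi / (\<i> * of_real (sinh x)) = - \<i> * of_real pi * of_real (1 / x - 1 / sinh x)"
    by (simp add: z_def divide_inverse algebra_simps)
  finally have "(\<lambda>N. \<i> / of_real pi * (- \<i> * of_real pi * of_real (\<Sum>k<2 * N. (-1) ^ k * pole_pair (Suc k) x)))
      \<longlonglongrightarrow> \<i> / of_real pi * (- \<i> * of_real pi * of_real (1 / x - 1 / sinh x))"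
    by (rule tendsto_mult_left)
  moreover have "\<i> / of_real pi * (- \<i> * of_real pi * of_real y) = complex_of_real y" for y
    by simp
  ultimately show ?thesis by (simp only: tendsto_of_real_iff)
qed

subsection \<open>The functional equation\<close>

text \<open>The extra \<open>d (2 * N)\<close> strengthens the induction hypothesis: it absorbs the
  next two terms.\<close>

lemma alternating_sum_bounds:
  fixes d :: "nat \<Rightarrow> real"
  assumes "decseq d" "\<And>k. 0 \<le> d k"
  shows "0 \<le> (\<Sum>k<2 * N. (-1) ^ k * d k) \<and> (\<Sum>k<2 * N. (-1) ^ k * d k) + d (2 * N) \<le> d 0"
proof (induction N)
  case (Suc N)
  have "d (2 * N + 1) \<le> d (2 * N)" "d (2 * N + 2) \<le> d (2 * N + 1)"
    using assms(1) by (auto simp: decseq_def)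
  then show ?case using Suc by simp
qed (use assms in simp)

text \<open>The alternating sum is bounded by its first term, uniformly in N. Without signs the full
  sum would be coth x - 1/x, which tends to 1 at infinity and so has no majorant of order
  1/x.\<close>

lemma pole_pair_partial_bound:
  assumes "0 < x"
  shows "\<bar>\<Sum>k<2 * N. (-1) ^ k * pole_pair (Suc k) x\<bar> \<le> 2 * min 1 (1 / x)"
proof -
  have pos: "0 < x\<^sup>2 + (real k * pi)\<^sup>2" for k using assms by (simp add: add_pos_nonneg)
  have "decseq (\<lambda>k. pole_pair (Suc k) x)"
    unfolding decseq_def pole_pair_def
    using assms by (intro allI impI divide_left_mono add_left_mono power_mono mult_right_mono mult_pos_pos pos) auto
  moreover have nonneg: "0 \<le> pole_pair (Suc k) x" for k
    using assms pos[of "Suc k"] by (simp add: pole_pair_def)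
  ultimately have "0 \<le> (\<Sum>k<2 * N. (-1) ^ k * pole_pair (Suc k) x) \<and>
      (\<Sum>k<2 * N. (-1) ^ k * pole_pair (Suc k) x) + pole_pair (Suc (2 * N)) x \<le> pole_pair (Suc 0) x"
    by (rule alternating_sum_bounds)
  with nonneg[of "2 * N"] have le: "\<bar>\<Sum>k<2 * N. (-1) ^ k * pole_pair (Suc k) x\<bar> \<le> pole_pair 1 x"
    by simp
  have "2 * x \<le> x\<^sup>2 + 1"
    using zero_le_power2[of "x - 1"] by (simp add: power2_diff)
  moreover have "1 \<le> pi\<^sup>2" using pi_ge_two by (intro one_le_power) simp
  ultimately have "x \<le> x\<^sup>2 + pi\<^sup>2" using assms by linarith
  then have "pole_pair 1 x \<le> 2 * min 1 (1 / x)"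
    using assms pos[of 1] by (auto simp: pole_pair_def min_def divide_simps power2_eq_square)
  with le show ?thesis by simp
qed

text \<open>The common shape of all \<open>pole_pair k\<close> with k > 0, which differ from it only
  by scaling with 1/(k \<pi>) and a constant factor.\<close>

definition cauchy_kernel :: "real \<Rightarrow> real" where
  "cauchy_kernel x = x / (1 + x\<^sup>2)"

lemma measurable_cauchy_kernel [measurable]: "cauchy_kernel \<in> borel_measurable borel"
  unfolding cauchy_kernel_def by measurable

lemma abs_cauchy_kernel_le:
  assumes "0 < x"
  shows "\<bar>cauchy_kernel x\<bar> \<le> min 1 (1 / x)"
proof -
  have "x \<le> 1 + x * x"
    using zero_le_square[of "x - 1"] assms by (simp add: algebra_simps)
  moreover have "0 < 1 + x * x" using assms by (simp add: add_pos_pos)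
  ultimately show ?thesis
    using assms by (auto simp: cauchy_kernel_def power2_eq_square divide_simps)
qed

lemma mellin_integrable_cauchy_kernel:
  assumes "0 < Re s" "Re s < 1"
  shows "mellin_integrable cauchy_kernel s"
  by (rule mellin_integrable_bound[OF _ set_integrable_min]) (use assms abs_cauchy_kernel_le in auto)

text \<open>Scaling by a = 1/(k \<pi>), together with the prefactor a, gives a^(1 - s). Its
  dependence on k is k^(-(1 - s)), the modulus-carrying part of a term of \<eta>(1 - s).\<close>

lemma
  assumes "0 < Re s" "Re s < 1" "0 < k"
  shows mellin_integrable_pole_pair: "mellin_integrable (pole_pair k) s"
    and mellin_pole_pair: "mellin (pole_pair k) s
      = 2 * of_real pi powr (s - 1) * mellin cauchy_kernel s / of_nat k powr (1 - s)"
proof -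
  define a where "a = 1 / (real k * pi)"
  have a: "0 < a" using assms by (simp add: a_def)
  have eq: "pole_pair k = (\<lambda>x. 2 * a * cauchy_kernel (a * x))"
  proof
    fix x
    have "1 + (a * x)\<^sup>2 = a\<^sup>2 * (x\<^sup>2 + (real k * pi)\<^sup>2)"
      using assms(3) by (simp add: a_def field_simps)
    then show "pole_pair k x = 2 * a * cauchy_kernel (a * x)"
      using a by (simp add: cauchy_kernel_def pole_pair_def power2_eq_square)
  qed
  show "mellin_integrable (pole_pair k) s"
    unfolding eq using a mellin_integrable_cauchy_kernel[OF assms(1,2)]
    by (intro mellin_integrable_cmult) (simp add: mellin_integrable_scale)
  have "of_real a * complex_of_real a powr (- s) = of_real a powr (1 - s)"
    using a by (simp add: powr_diff powr_minus field_simps)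
  also have "\<dots> = of_real pi powr (s - 1) / of_nat k powr (1 - s)"
  proof -
    have "complex_of_real a powr (1 - s) * (of_nat k powr (1 - s) * of_real pi powr (1 - s))
        = (of_real a * (of_nat k * of_real pi)) powr (1 - s)"
      using a by (simp add: powr_times_real)
    also have "of_real a * (of_nat k * of_real pi) = (1 :: complex)"
      using assms(3) by (simp add: a_def)
    finally have "of_real a powr (1 - s) * of_nat k powr (1 - s) * complex_of_real pi powr (1 - s) = 1"
      by (simp add: mult.assoc)
    moreover have "complex_of_real pi powr (s - 1) * of_real pi powr (1 - s) = 1"
      by (simp flip: powr_add)
    ultimately have "of_real a powr (1 - s) * of_nat k powr (1 - s) = complex_of_real pi powr (s - 1)"
      by (metis mult_cancel_right mult_zero_right zero_neq_one)
    then show ?thesis using assms(3) by (simp add: field_simps)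
  qed
  finally have e: "of_real a * complex_of_real a powr (- s) = of_real pi powr (s - 1) / of_nat k powr (1 - s)" .
  have "mellin (pole_pair k) s = 2 * (of_real a * of_real a powr (- s)) * mellin cauchy_kernel s"
    unfolding eq mellin_cmult mellin_scale[OF a] by simp
  then show "mellin (pole_pair k) s
      = 2 * of_real pi powr (s - 1) * mellin cauchy_kernel s / of_nat k powr (1 - s)"
    unfolding e by simp
qed

text \<open>One sequence, two limits: dominated convergence under the integral, and termwise
  evaluation to partial sums of \<eta>(1 - s). Even cutoffs suffice because these partial sums
  converge.\<close>

lemma mellin_csch:
  assumes "0 < Re s" "Re s < 1"
  shows "mellin (\<lambda>x. 1 / x - 1 / sinh x) s
    = 2 * of_real pi powr (s - 1) * mellin cauchy_kernel s * dirichlet_eta (1 - s)"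
proof (rule LIMSEQ_unique)
  have bound: "set_integrable lborel {0<..} (\<lambda>x. x powr (Re s - 1) * (2 * min 1 (1 / x)))"
    using set_integrable_mult_right[OF set_integrable_min[OF assms], of 2] by (simp add: mult_ac)
  show "(\<lambda>N. mellin (\<lambda>x. \<Sum>k<2 * N. (-1) ^ k * pole_pair (Suc k) x) s)
      \<longlonglongrightarrow> mellin (\<lambda>x. 1 / x - 1 / sinh x) s"
    by (rule mellin_LIMSEQ[OF _ _ bound]) 
       (auto simp: pole_pair_partial_bound csch_LIMSEQ, auto simp: pole_pair_def sinh_field_def)
  have "mellin (\<lambda>x. \<Sum>k<2 * N. (-1) ^ k * pole_pair (Suc k) x) s
      = 2 * of_real pi powr (s - 1) * mellin cauchy_kernel s * eta_partial (2 * N) (1 - s)" for N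
  proof -
    have "mellin (\<lambda>x. \<Sum>k<2 * N. (-1) ^ k * pole_pair (Suc k) x) s
        = (\<Sum>k<2 * N. mellin (\<lambda>x. (-1) ^ k * pole_pair (Suc k) x) s)"
      by (intro mellin_sum mellin_integrable_cmult mellin_integrable_pole_pair assms) auto
    then show ?thesis
      by (simp add: mellin_cmult mellin_pole_pair assms eta_partial_conv_sum sum_distrib_left del: of_nat_Suc)
        (simp add: mult_ac del: of_nat_Suc)
  qed
  moreover have "(\<lambda>N. eta_partial (2 * N) (1 - s)) \<longlonglongrightarrow> dirichlet_eta (1 - s)"
    using assms by (intro filterlim_compose[OF dirichlet_eta_LIMSEQ mult_nat_left_at_top]) auto
  ultimately show "(\<lambda>N. mellin (\<lambda>x. \<Sum>k<2 * N. (-1) ^ k * pole_pair (Suc k) x) s)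
      \<longlonglongrightarrow> 2 * of_real pi powr (s - 1) * mellin cauchy_kernel s * dirichlet_eta (1 - s)"
    by (simp add: tendsto_mult_left)
qed

text \<open>Cross-multiplication of the two multiples of \<open>mellin planck s\<close>, using 2 -
  2u = -(2u - 2) and 1 - 2u = -(2u - 1) for u = 2^(-s).\<close>

lemma functional_equation:
  assumes "0 < Re s" "Re s < 1"
  shows "(2 - 2 * 2 powr (- s)) * Gamma s * dirichlet_eta s
    = (2 * 2 powr (- s) - 1) * (2 * of_real pi powr (s - 1) * mellin cauchy_kernel s) * dirichlet_eta (1 - s)"
proof -
  have "(2 - 2 * 2 powr (- s)) * mellin fermi s
      = (2 * 2 powr (- s) - 1) * mellin (\<lambda>x. 1 / x - 1 / sinh x) s"
    unfolding mellin_fermi_planck[OF assms] mellin_csch_planck[OF assms] by (simp add: algebra_simps)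
  then show ?thesis
    using assms by (simp add: mellin_fermi mellin_csch mult_ac)
qed

lemma functional_equation_factor_nonzero:
  assumes "0 < Re s"
  shows "(2 - 2 * 2 powr (- s)) * Gamma s \<noteq> 0"
proof -
  have "norm (2 powr (- s)) < 1"
    using assms norm_of_real_powr[of 2 "- s"] by (simp add: powr_less_one)
  then have "2 powr (- s) \<noteq> 1" by force
  with Gamma_nonzero_Re[OF assms] show ?thesis by simp
qed

text \<open>
  Read at \<open>1 - s\<close> the functional equation has \<open>dirichlet_eta s\<close> on the right, so the (true) fact that
  \<open>mellin cauchy_kernel\<close> has no zeros in the strip is not needed.
\<close>

lemma dirichlet_eta_zero_reflect:
  assumes "0 < Re s" "Re s < 1" "dirichlet_eta s = 0"
  shows "dirichlet_eta (1 - s) = 0"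
  using functional_equation[of "1 - s"] functional_equation_factor_nonzero[of "1 - s"] assms by simp

text \<open>For a \<le> \<sigma> \<le> b the weight x^(\<sigma> - 1) is at most x^(a - 1) + x^(b -
  1): the first summand dominates for x \<le> 1, the second for x > 1.\<close>

lemma norm_mellin_cauchy_kernel_bounded:
  assumes "0 < a" "b < 1"
  shows "\<exists>K. \<forall>s. a \<le> Re s \<longrightarrow> Re s \<le> b \<longrightarrow> norm (mellin cauchy_kernel s) \<le> K"
proof (cases "a \<le> b")
  case True
  let ?W = "\<lambda>\<sigma> x. x powr (\<sigma> - 1) * min 1 (1 / x)"
  have int: "set_integrable lborel {0<..} (?W a)" "set_integrable lborel {0<..} (?W b)"
    using assms True by (auto intro: set_integrable_min)
  show ?thesis
  proof (intro exI allI impI)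
    fix s assume s: "a \<le> Re s" "Re s \<le> b"
    have "norm (mellin cauchy_kernel s) \<le> (LINT x:{0<..}|lborel. ?W (Re s) x)"
      using s assms by (intro norm_mellin_le abs_cauchy_kernel_le set_integrable_min) auto
    also have "\<dots> \<le> (LINT x:{0<..}|lborel. ?W a x + ?W b x)"
    proof (rule set_integral_mono)
      show "set_integrable lborel {0<..} (?W (Re s))"
        using s assms by (intro set_integrable_min) auto
      show "set_integrable lborel {0<..} (\<lambda>x. ?W a x + ?W b x)"
        using int by (rule set_integral_add)
      fix x :: real assume x: "x \<in> {0<..}"
      have "x powr (Re s - 1) \<le> x powr (a - 1) + x powr (b - 1)"
      proof (cases "x \<le> 1")
        case True
        then have "x powr (Re s - 1) \<le> x powr (a - 1)"
          using x s by (intro powr_mono') auto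
        then show ?thesis using powr_ge_zero[of x "b - 1"] by linarith
      next
        case False
        then have "x powr (Re s - 1) \<le> x powr (b - 1)"
          using x s by (intro powr_mono) auto
        then show ?thesis using powr_ge_zero[of x "a - 1"] by linarith
      qed
      then show "?W (Re s) x \<le> ?W a x + ?W b x"
        using x by (simp add: mult_right_mono flip: distrib_right)
    qed
    finally show "norm (mellin cauchy_kernel s) \<le> (LINT x:{0<..}|lborel. ?W a x + ?W b x)" .
  qed
qed auto

subsection \<open>The limit of the quotients\<close>

lemma eta_quotient_limit_nonzero:
  assumes "0 < Re s" "Re s < 1" "dirichlet_eta s \<noteq> 0"
  shows "\<forall>\<^sub>F n in sequentially. eta_partial n s \<noteq> 0"
    and "eta_quotient s \<longlonglongrightarrow> dirichlet_eta (1 - s) / dirichlet_eta s"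
proof -
  show "\<forall>\<^sub>F n in sequentially. eta_partial n s \<noteq> 0"
    using tendsto_imp_eventually_ne[OF dirichlet_eta_LIMSEQ] assms by blast
  show "eta_quotient s \<longlonglongrightarrow> dirichlet_eta (1 - s) / dirichlet_eta s"
    unfolding eta_quotient_def using assms by (intro tendsto_divide dirichlet_eta_LIMSEQ) auto
qed

text \<open>By reflection 1 - s is a zero too, so both partial sums are pure remainders. The signs
  cancel, the coefficients \<open>c\<close> both tend to 1/2, and the powers leave n^(-(1 - 2s)),
  which vanishes because Re s < 1/2. The limit of \<open>c s\<close> also makes the denominators
  eventually nonzero.\<close>

lemma eta_quotient_limit_zero:
  assumes "0 < Re s" "Re s < 1 / 2" "dirichlet_eta s = 0"
  shows "\<forall>\<^sub>F n in sequentially. eta_partial n s \<noteq> 0"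
    and "eta_quotient s \<longlonglongrightarrow> 0"
proof -
  define c where "c z n = eta_rem n z / Gamma z" for z n
  have c: "c z \<longlonglongrightarrow> 1 / 2" if "0 < Re z" for z
    using tendsto_divide[OF eta_rem_LIMSEQ[OF that] tendsto_const, of "Gamma z"] Gamma_nonzero_Re[OF that]
    by (simp add: c_def[abs_def])
  have zero: "dirichlet_eta (1 - s) = 0"
    using dirichlet_eta_zero_reflect assms by simp
  have nz: "\<forall>\<^sub>F n in sequentially. c s n \<noteq> 0"
    using tendsto_imp_eventually_ne[OF c] assms by simp
  have partial: "eta_partial n z = - ((-1) ^ n * of_nat n powr (- z) * c z n)"
    if "z = s \<or> z = 1 - s" "0 < n" for n z
    using eta_partial_eq[of z n] that assms zero by (auto simp: c_def)
  show "\<forall>\<^sub>F n in sequentially. eta_partial n s \<noteq> 0"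
    using nz eventually_gt_at_top[of 0]
    by eventually_elim (simp add: partial)
  have "(\<lambda>n. of_nat n powr (- (1 - 2 * s)) * (c (1 - s) n / c s n)) \<longlonglongrightarrow> 0 * (1 / 2 / (1 / 2))"
    using assms by (intro tendsto_mult tendsto_divide c of_nat_powr_minus_tendsto_0) auto
  moreover have "\<forall>\<^sub>F n in sequentially. of_nat n powr (- (1 - 2 * s)) * (c (1 - s) n / c s n) = eta_quotient s n"
    using eventually_gt_at_top[of 0]
  proof eventually_elim
    case (elim n)
    have "complex_of_nat n powr (- (1 - s)) = of_nat n powr (- (1 - 2 * s)) * of_nat n powr (- s)"
      by (simp add: algebra_simps flip: powr_add)
    then show ?case
      using elim by (simp add: eta_quotient_def partial)
  qed
  ultimately show "eta_quotient s \<longlonglongrightarrow> 0"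
    by (simp add: Lim_transform_eventually)
qed

text \<open>At zeros of \<eta> the formula holds by the convention x / 0 = 0, which agrees with the
  actual limit 0.\<close>

lemma eta_quotient_limit_eq:
  assumes "s \<in> left_half_strip"
  shows "eta_quotient_limit s = dirichlet_eta (1 - s) / dirichlet_eta s"
  using assms eta_quotient_limit_nonzero(2)[of s] eta_quotient_limit_zero(2)[of s]
  by (cases "dirichlet_eta s = 0") (auto simp: left_half_strip_def eta_quotient_limit_def intro!: limI)

lemma eta_quotient_limit_existsI:
  assumes "s \<in> left_half_strip"
  shows "eta_quotient_limit_exists s"
proof -
  have "\<forall>\<^sub>F n in sequentially. eta_partial n s \<noteq> 0" "convergent (eta_quotient s)"
    using assms eta_quotient_limit_nonzero[of s] eta_quotient_limit_zero[of s]
    by (cases "dirichlet_eta s = 0"; force simp: left_half_strip_def intro: convergentI)+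
  then show ?thesis
    by (auto simp: eta_quotient_limit_exists_def eventually_at_top_dense)
qed

section \<open>Continuity of the limit function and zeros of \<eta>\<close>

lemma not_continuous_at_zero:
  assumes s: "s \<in> left_half_strip" and zero: "dirichlet_eta s = 0"
  shows "\<not> continuous_on left_half_strip eta_quotient_limit"
proof
  assume "continuous_on left_half_strip eta_quotient_limit"
  moreover have op: "open left_half_strip"
    unfolding left_half_strip_def
    by (intro open_Collect_conj open_halfspace_Re_gt open_halfspace_Re_lt)
  ultimately have "isCont eta_quotient_limit s"
    using s by (simp add: continuous_on_eq_continuous_at)
  then have L: "(eta_quotient_limit \<longlongrightarrow> 0) (at s)"
    using eta_quotient_limit_eq[OF s] zero by (simp add: isCont_def)
  \<comment> \<open>The substrip from Re s / 2 to 1/2 contains all points of the strip sufficiently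
    near s.\<close>
  obtain K where K: "\<And>z. Re s / 2 \<le> Re z \<Longrightarrow> Re z \<le> 1 / 2 \<Longrightarrow> norm (mellin cauchy_kernel z) \<le> K"
    using norm_mellin_cauchy_kernel_bounded[of "Re s / 2" "1 / 2"] s by (auto simp: left_half_strip_def)
  define A where "A z = (2 - 2 * 2 powr (- z)) * Gamma z" for z :: complex
  define E where "E z = (2 * 2 powr (- z) - 1) * (2 * of_real pi powr (z - 1))" for z :: complex
  have A: "isCont A s"
    unfolding A_def using s
    by (intro continuous_intros isCont_Gamma) (auto simp: left_half_strip_def elim!: nonpos_Ints_cases)
  have E: "isCont E s"
    unfolding E_def by (intro continuous_intros) auto
  have "\<forall>\<^sub>F z in at s. z \<in> left_half_strip"
    using op s by (intro eventually_at_in_open') auto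
  moreover have "\<forall>\<^sub>F z in at s. Re s / 2 < Re z"
    using s by (intro order_tendstoD(1)[OF tendsto_Re[OF tendsto_ident_at]]) (simp add: left_half_strip_def)
  moreover have "\<forall>\<^sub>F z in at s. dirichlet_eta z \<noteq> 0"
    using s zero by (intro dirichlet_eta_isolated_zero) (simp_all add: left_half_strip_def)
  \<comment> \<open>Near s the value \<eta>(z) is nonzero and cancels from the functional equation,
    leaving \<open>A z\<close> as a bounded multiple of the limit function.\<close>
  ultimately have "\<forall>\<^sub>F z in at s. norm (A z) \<le> norm (E z) * K * norm (eta_quotient_limit z)"
  proof eventually_elim
    case (elim z)
    have strip: "0 < Re z" "Re z < 1" "Re z < 1 / 2"
      using elim by (auto simp: left_half_strip_def)
    have "A z * dirichlet_eta z = E z * mellin cauchy_kernel z * dirichlet_eta (1 - z)"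
      using functional_equation[OF strip(1,2)] by (simp add: A_def E_def mult_ac)
    moreover have "dirichlet_eta (1 - z) = eta_quotient_limit z * dirichlet_eta z"
      using elim eta_quotient_limit_eq[of z] by simp
    ultimately have "A z * dirichlet_eta z = E z * mellin cauchy_kernel z * eta_quotient_limit z * dirichlet_eta z"
      by (simp only: mult.assoc)
    then have "A z = E z * mellin cauchy_kernel z * eta_quotient_limit z"
      using elim by simp
    then have "norm (A z) = norm (E z) * norm (mellin cauchy_kernel z) * norm (eta_quotient_limit z)"
      by (simp add: norm_mult)
    also have "\<dots> \<le> norm (E z) * K * norm (eta_quotient_limit z)"
      using K[of z] elim strip by (intro mult_right_mono mult_left_mono) auto
    finally show ?case .
  qed
  moreover have "((\<lambda>z. norm (A z)) \<longlongrightarrow> norm (A s)) (at s)"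
    using A by (intro tendsto_norm) (simp add: isCont_def)
  moreover have "((\<lambda>z. norm (E z) * K * norm (eta_quotient_limit z)) \<longlongrightarrow> norm (E s) * K * norm (0 :: complex)) (at s)"
    using E L by (intro tendsto_intros) (simp add: isCont_def)
  \<comment> \<open>Letting z tend to s, continuity would force \<open>A s\<close> = 0.\<close>
  ultimately have "norm (A s) \<le> norm (E s) * K * norm (0 :: complex)"
    by (intro tendsto_le[OF _ _ _ _]) auto
  moreover have "A s \<noteq> 0"
    unfolding A_def using s by (intro functional_equation_factor_nonzero) (simp add: left_half_strip_def)
  ultimately show False by simp
qed

lemma continuous_without_zeros:
  assumes "\<forall>s\<in>left_half_strip. dirichlet_eta s \<noteq> 0"
  shows "continuous_on left_half_strip eta_quotient_limit"
proof -
  have eta: "continuous_on {s. 0 < Re s} dirichlet_eta"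
    by (rule holomorphic_on_imp_continuous_on[OF holomorphic_dirichlet_eta])
  have "continuous_on left_half_strip (\<lambda>s. dirichlet_eta (1 - s) / dirichlet_eta s)"
    using assms
    by (intro continuous_on_divide continuous_on_compose2[OF eta] continuous_intros)
       (auto simp: left_half_strip_def)
  then show ?thesis
    by (simp add: eta_quotient_limit_eq cong: continuous_on_cong)
qed

theorem theorem2:
  "(\<forall>s\<in>left_half_strip. eta_quotient_limit_exists s) \<and>
   (continuous_on left_half_strip eta_quotient_limit \<longleftrightarrow>
     (\<forall>s\<in>left_half_strip. dirichlet_eta s \<noteq> 0))"
  using eta_quotient_limit_existsI not_continuous_at_zero continuous_without_zeros by blast

end
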